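(* Let $h:\mathbb{R}^n\to\mathbb{R}$ be convex and absolutely homogeneous, let $g:\mathbb{R}^n\to\mathbb{R}$ be smooth, and let $\boldsymbol{x}_k\in\mathcal{S}$. Let $t'\neq 0$ be a real number (a proxy step-size), put $$\boldsymbol{z}=\mathrm{prox}_{|t'|h}\left(\boldsymbol{x}_k-t'\,\mathrm{grad}\,g|_{\boldsymbol{x}_k}\right),$$ suppose $\boldsymbol{x}_k^{\mathsf T}\boldsymbol{z}\neq 0$, and define $$t=\frac{1}{\boldsymbol{x}_k^{\mathsf T}\boldsymbol{z}}\,t',\qquad \boldsymbol{v}_k=\frac{1}{\boldsymbol{x}_k^{\mathsf T}\boldsymbol{z}}\,\boldsymbol{z}-\boldsymbol{x}_k .$$ If $t>0$, then $\boldsymbol{v}_k$ is the solution of the subproblem with step-size $t$: $$\boldsymbol{v}_k=\arg\min_{\boldsymbol{v}\in\mathcal{T}_{\boldsymbol{x}_k}\mathcal{S}}\ \langle \mathrm{grad}\,g|_{\boldsymbol{x}_k},\boldsymbol{v}\rangle+\frac{1}{2t}\langle\boldsymbol{v},\boldsymbol{v}\rangle+h(\boldsymbol{x}_k+\boldsymbol{v}).$$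
   Context: $\mathcal{S}=\{\boldsymbol{x}\in\mathbb{R}^n:\|\boldsymbol{x}\|_2=1\}$ is the unit sphere, with tangent space $\mathcal{T}_{\boldsymbol{x}}\mathcal{S}=\{\boldsymbol{v}\in\mathbb{R}^n:\boldsymbol{x}^{\mathsf T}\boldsymbol{v}=0\}$ and the Euclidean inner product as metric. The Riemannian gradient of $g$ at $\boldsymbol{x}\in\mathcal{S}$ is $\mathrm{grad}\,g|_{\boldsymbol{x}}=(\boldsymbol{I}-\boldsymbol{x}\boldsymbol{x}^{\mathsf T})\nabla g|_{\boldsymbol{x}}$, where $\nabla g$ is the Euclidean gradient. A function $h$ is absolutely homogeneous if $h(\alpha\boldsymbol{x})=|\alpha|h(\boldsymbol{x})$ for all scalars $\alpha$ and vectors $\boldsymbol{x}$. For $s\ge 0$, $\mathrm{prox}_{sh}(\boldsymbol{w})=\arg\min_{\boldsymbol{x}}\{s\,h(\boldsymbol{x})+\frac12\|\boldsymbol{x}-\boldsymbol{w}\|_2^2\}$. *)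

theory Defs
  imports "HOL-Analysis.Analysis"
begin

definition abs_homogeneous :: "(real^'n \<Rightarrow> real) \<Rightarrow> bool" where
  "abs_homogeneous h \<longleftrightarrow> (\<forall>\<alpha> x. h (\<alpha> *\<^sub>R x) = \<bar>\<alpha>\<bar> * h x)"

text \<open>\<^const>\<open>gderiv\<close> is the relation behind the notation \<open>GDERIV g x :> D\<close>; the gradient is its
  value, which is unique whenever \<open>g\<close> is differentiable at \<open>x\<close>.\<close>

definition gradient :: "(real^'n \<Rightarrow> real) \<Rightarrow> real^'n \<Rightarrow> real^'n" where
  "gradient g x = (THE D. GDERIV g x :> D)"

text \<open>Smoothness is taken in the sense of composite optimization, i.e. continuously
  differentiable. This is implied by \<open>C\<^sup>\<infinity>\<close> and by having a Lipschitz gradient.\<close>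

definition smooth :: "(real^'n \<Rightarrow> real) \<Rightarrow> bool" where
  "smooth g \<longleftrightarrow> (\<forall>x. g differentiable (at x)) \<and> continuous_on UNIV (gradient g)"

definition outer :: "real^'n \<Rightarrow> real^'n \<Rightarrow> real^'n^'n" where
  "outer x y = (\<chi> i j. x $ i * y $ j)"

definition tangent_space :: "real^'n \<Rightarrow> (real^'n) set" where
  "tangent_space x = {v. x \<bullet> v = 0}"

definition riem_grad :: "(real^'n \<Rightarrow> real) \<Rightarrow> real^'n \<Rightarrow> real^'n" where
  "riem_grad g x = (mat 1 - outer x x) *v gradient g x"

text \<open>The library's \<^const>\<open>arg_min\<close> chooses some minimizer. For \<open>s \<ge> 0\<close> and convex real-valued
  \<open>h\<close> the objective has exactly one, so nothing depends on the choice.\<close>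

definition prox :: "real \<Rightarrow> (real^'n \<Rightarrow> real) \<Rightarrow> real^'n \<Rightarrow> real^'n" where
  "prox s h w = arg_min (\<lambda>x. s * h x + 1/2 * (norm (x - w))\<^sup>2) (\<lambda>x. True)"

text \<open>\<open>u\<close> is the argmin of \<open>f\<close> over \<open>S\<close>: a global minimizer, and the only one.\<close>

definition is_the_argmin :: "('a \<Rightarrow> real) \<Rightarrow> 'a set \<Rightarrow> 'a \<Rightarrow> bool" where
  "is_the_argmin f S u \<longleftrightarrow>
     is_arg_min f (\<lambda>v. v \<in> S) u \<and> (\<forall>v. is_arg_min f (\<lambda>v. v \<in> S) v \<longrightarrow> v = u)"

end

theory Submission
  imports Defs
begin

text \<open>Put \<open>c = x\<^sub>k \<bullet> z\<close>. On the tangent space, absolute homogeneity turns the proximal objective at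
  \<open>c *\<^sub>R (x\<^sub>k + v)\<close> into \<open>c * t'\<close> times the subproblem objective at \<open>v\<close>, plus a constant; here
  \<open>c * t' > 0\<close> because \<open>t > 0\<close>. As \<open>z = c *\<^sub>R (x\<^sub>k + v\<^sub>k)\<close> is the unique global minimizer of the
  former, \<open>v\<^sub>k\<close> is the unique minimizer of the latter.\<close>

lemma abs_homogeneous_0: "abs_homogeneous h \<Longrightarrow> h 0 = 0"
  unfolding abs_homogeneous_def by (metis abs_zero mult_zero_left scaleR_zero_left)

text \<open>Homogeneity makes \<open>h\<close> even, and \<open>0\<close> is the midpoint of
  \<open>x\<close> and \<open>- x\<close>, so convexity bounds \<open>h 0 = 0\<close> by
  \<open>h x\<close>.\<close>

lemma abs_homogeneous_convex_nonneg:
  assumes "abs_homogeneous h" and "convex_on UNIV h"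
  shows "0 \<le> h x"
proof -
  have "h (- x) = h x"
    using assms(1)[unfolded abs_homogeneous_def, rule_format, of "-1" x] by simp
  moreover have "h ((1 - 1/2) *\<^sub>R x + (1/2) *\<^sub>R (- x)) \<le> (1 - 1/2) * h x + 1/2 * h (- x)"
    by (rule convex_onD[OF assms(2)]) auto
  ultimately show ?thesis
    using abs_homogeneous_0[OF assms(1)] by simp
qed

text \<open>\<open>prox\<close> is defined by choice, so it is informative only once some minimizer
  is known to exist. Continuity of \<open>h\<close> gives one on a compact ball, and the ball is
  large enough to make it global.\<close>

lemma prox_objective_le_prox:
  fixes h :: "real^'n \<Rightarrow> real"
  assumes "convex_on UNIV h" and "\<And>x. 0 \<le> h x" and "h 0 = 0" and "0 \<le> s"
  shows "s * h (prox s h w) + 1/2 * (norm (prox s h w - w))\<^sup>2 \<le> s * h y + 1/2 * (norm (y - w))\<^sup>2"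
proof -
  let ?P = "\<lambda>x. s * h x + 1/2 * (norm (x - w))\<^sup>2"
  have "continuous_on UNIV h"
    using assms(1) by (intro convex_on_continuous) auto
  then have "continuous_on (cball w (norm w)) h"
    by (rule continuous_on_subset) simp
  then have "continuous_on (cball w (norm w)) ?P"
    by (intro continuous_intros)
  then obtain a where a: "\<And>x. x \<in> cball w (norm w) \<Longrightarrow> ?P a \<le> ?P x"
    using continuous_attains_inf[of "cball w (norm w)" ?P] compact_cball by fastforce
  have "?P a \<le> ?P x" for x
  proof (cases "x \<in> cball w (norm w)")
    \<comment> \<open>The radius \<open>norm w\<close> puts \<open>0\<close> in the ball, with
      objective value \<open>1/2 * (norm w)\<^sup>2\<close>; outside the ball the quadratic term
      alone is at least that.\<close>
    case False
    have "?P a \<le> ?P 0"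
      by (rule a) (simp add: dist_norm)
    then have "?P a \<le> 1/2 * (norm w)\<^sup>2"
      using assms(3) by simp
    moreover have "(norm w)\<^sup>2 \<le> (norm (x - w))\<^sup>2"
      using False by (intro power_mono) (auto simp: dist_norm norm_minus_commute)
    moreover have "0 \<le> s * h x"
      using assms by simp
    ultimately show ?thesis
      by linarith
  qed (rule a)
  then have "is_arg_min ?P (\<lambda>_. True) a"
    by (simp add: is_arg_min_linorder)
  then have "is_arg_min ?P (\<lambda>_. True) (prox s h w)"
    unfolding prox_def arg_min_def by (rule someI)
  then show ?thesis
    by (simp add: is_arg_min_linorder)
qed

text \<open>Strong convexity at the midpoint \<open>m\<close>: the parallelogram law lowers the
  average of the two minimal values by \<open>1/8 * (norm (a - b))\<^sup>2\<close>, which minimality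
  forces to vanish.\<close>

lemma prox_objective_minimizer_unique:
  fixes h :: "'a::real_inner \<Rightarrow> real"
  assumes "convex_on UNIV h" and "0 \<le> s"
    and a: "\<And>x. s * h a + 1/2 * (norm (a - w))\<^sup>2 \<le> s * h x + 1/2 * (norm (x - w))\<^sup>2"
    and b: "\<And>x. s * h b + 1/2 * (norm (b - w))\<^sup>2 \<le> s * h x + 1/2 * (norm (x - w))\<^sup>2"
  shows "a = b"
proof -
  define m where "m = (1 - 1/2) *\<^sub>R a + (1/2) *\<^sub>R b"
  have "h m \<le> (1 - 1/2) * h a + 1/2 * h b"
    unfolding m_def by (rule convex_onD[OF assms(1)]) auto
  then have "s * h m \<le> s * ((1 - 1/2) * h a + 1/2 * h b)"
    using assms(2) by (rule mult_left_mono)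
  then have "s * h m \<le> 1/2 * (s * h a) + 1/2 * (s * h b)"
    by (simp add: algebra_simps)
  moreover have "(norm (m - w))\<^sup>2
      = 1/2 * (norm (a - w))\<^sup>2 + 1/2 * (norm (b - w))\<^sup>2 - 1/4 * (norm (a - b))\<^sup>2"
    unfolding m_def power2_norm_eq_inner
    by (simp add: algebra_simps inner_commute)
  ultimately have "(norm (a - b))\<^sup>2 \<le> 0"
    using a[of m] b[of m] by linarith
  then show ?thesis
    by simp
qed

lemma outer_mult_vec: "outer x y *v d = (y \<bullet> d) *\<^sub>R x"
  by (simp add: vec_eq_iff outer_def matrix_vector_mult_def inner_vec_def sum_distrib_left
      sum_distrib_right mult_ac)

text \<open>For a unit vector, \<open>mat 1 - outer x x\<close> is the orthogonal projection that
  removes the component along \<open>x\<close>.\<close>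

lemma inner_riem_grad:
  assumes "x \<bullet> x = 1"
  shows "x \<bullet> riem_grad g x = 0"
  using assms
  by (simp add: riem_grad_def matrix_vector_mult_diff_rdistrib outer_mult_vec inner_diff_right)

theorem mainTheorem1:
  fixes h g :: "real^'n \<Rightarrow> real"
    and x\<^sub>k z v\<^sub>k :: "real^'n"
    and t' t :: real
  assumes "convex_on UNIV h"
    and "abs_homogeneous h"
    and "smooth g"
    and "x\<^sub>k \<in> sphere 0 1"
    and "t' \<noteq> 0"
    and "z = prox \<bar>t'\<bar> h (x\<^sub>k - t' *\<^sub>R riem_grad g x\<^sub>k)"
    and "x\<^sub>k \<bullet> z \<noteq> 0"
    and "t = 1 / (x\<^sub>k \<bullet> z) * t'"
    and "v\<^sub>k = (1 / (x\<^sub>k \<bullet> z)) *\<^sub>R z - x\<^sub>k"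
    and "t > 0"
  shows "is_the_argmin
           (\<lambda>v. riem_grad g x\<^sub>k \<bullet> v + 1 / (2 * t) * (v \<bullet> v) + h (x\<^sub>k + v))
           (tangent_space x\<^sub>k) v\<^sub>k"
proof -
  define c where "c = x\<^sub>k \<bullet> z"
  define G where "G = riem_grad g x\<^sub>k"
  define w where "w = x\<^sub>k - t' *\<^sub>R G"
  define P where "P y = \<bar>t'\<bar> * h y + 1/2 * (norm (y - w))\<^sup>2" for y
  define F where "F v = G \<bullet> v + 1 / (2 * t) * (v \<bullet> v) + h (x\<^sub>k + v)" for v
  have c: "c \<noteq> 0" and t: "t = t' / c"
    using assms(7,8) by (auto simp: c_def)
  have ct': "0 < c * t'"
    using assms(10) by (auto simp: t zero_less_divide_iff zero_less_mult_iff)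
  have xx: "x\<^sub>k \<bullet> x\<^sub>k = 1"
    using assms(4) by (simp add: norm_eq_1)
  have xG: "x\<^sub>k \<bullet> G = 0"
    unfolding G_def by (rule inner_riem_grad[OF xx])
  have z_min: "P z \<le> P y" for y
    unfolding P_def assms(6) w_def G_def
    using assms(1,2) abs_homogeneous_0 abs_homogeneous_convex_nonneg
    by (intro prox_objective_le_prox) auto
  have z_unique: "y = z" if "\<And>x. P y \<le> P x" for y
    using that z_min unfolding P_def
    by (intro prox_objective_minimizer_unique[OF assms(1), of "\<bar>t'\<bar>"]) auto
  have P_eq: "P (c *\<^sub>R (x\<^sub>k + v)) = c * t' * F v + (c\<^sup>2 / 2 - c + 1/2 * (w \<bullet> w))"
    if v: "x\<^sub>k \<bullet> v = 0" for v
  proof -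
    have "\<bar>t'\<bar> * h (c *\<^sub>R (x\<^sub>k + v)) = c * t' * h (x\<^sub>k + v)"
    proof -
      \<comment> \<open>The factor \<open>\<bar>c\<bar>\<close> from homogeneity merges with the
        prox parameter \<open>\<bar>t'\<bar>\<close>; positivity of \<open>c * t'\<close> then
        removes the absolute value.\<close>
      have "\<bar>t'\<bar> * h (c *\<^sub>R (x\<^sub>k + v)) = \<bar>c * t'\<bar> * h (x\<^sub>k + v)"
        using assms(2)[unfolded abs_homogeneous_def, rule_format, of c "x\<^sub>k + v"]
        by (simp add: abs_mult)
      then show ?thesis
        using ct' by simp
    qed
    moreover have "(norm (c *\<^sub>R (x\<^sub>k + v) - w))\<^sup>2
        = c\<^sup>2 * (1 + v \<bullet> v) - 2 * c + 2 * (c * t') * (G \<bullet> v) + w \<bullet> w"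
    proof -
      have "(norm (c *\<^sub>R (x\<^sub>k + v) - w))\<^sup>2
          = c\<^sup>2 * ((x\<^sub>k + v) \<bullet> (x\<^sub>k + v)) - 2 * c * ((x\<^sub>k + v) \<bullet> w) + w \<bullet> w"
        unfolding power2_norm_eq_inner
        by (simp add: inner_diff_left inner_diff_right inner_commute power2_eq_square)
      moreover have "(x\<^sub>k + v) \<bullet> (x\<^sub>k + v) = 1 + v \<bullet> v"
        using v xx by (simp add: inner_add_left inner_add_right inner_commute)
      \<comment> \<open>Both \<open>v\<close> and \<open>G\<close> are orthogonal to the unit vector
        \<open>x\<^sub>k\<close>, so the mixed terms drop out.\<close>
      moreover have "(x\<^sub>k + v) \<bullet> w = 1 - t' * (G \<bullet> v)"
        using v xx xG
        by (simp add: w_def inner_add_left inner_add_right inner_diff_right inner_commute)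
      ultimately have "(norm (c *\<^sub>R (x\<^sub>k + v) - w))\<^sup>2
          = c\<^sup>2 * (1 + v \<bullet> v) - 2 * c * (1 - t' * (G \<bullet> v)) + w \<bullet> w"
        by (simp only:)
      then show ?thesis
        by (simp add: right_diff_distrib)
    qed
    \<comment> \<open>This matching of quadratic coefficients is what dictates the step-size
      \<open>t = t' / c\<close>.\<close>
    moreover have "c * t' * (1 / (2 * t) * (v \<bullet> v)) = c\<^sup>2 / 2 * (v \<bullet> v)"
      using c assms(5) by (simp add: t power2_eq_square)
    ultimately show ?thesis
      unfolding P_def F_def distrib_left by linarith
  qed
  have F_le_iff: "F u \<le> F v \<longleftrightarrow> P (c *\<^sub>R (x\<^sub>k + u)) \<le> P (c *\<^sub>R (x\<^sub>k + v))"
    if "x\<^sub>k \<bullet> u = 0" "x\<^sub>k \<bullet> v = 0" for u v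
    using that mult_le_cancel_left_pos[OF ct'] by (simp add: P_eq)
  have z: "c *\<^sub>R (x\<^sub>k + v\<^sub>k) = z"
    using c by (simp add: assms(9) flip: c_def)
  \<comment> \<open>Dividing \<open>z\<close> by \<open>c\<close> makes its component along
    \<open>x\<^sub>k\<close> equal to 1, which subtracting \<open>x\<^sub>k\<close> cancels.\<close>
  have v\<^sub>k: "x\<^sub>k \<bullet> v\<^sub>k = 0"
    using c xx by (simp add: assms(9) inner_diff_right flip: c_def)
  \<comment> \<open>The points \<open>c *\<^sub>R (x\<^sub>k + v)\<close> with \<open>v\<close>
    tangent fill only a hyperplane, but \<open>z\<close> lies on it and minimizes \<open>P\<close>
    over the whole space.\<close>
  have "is_arg_min F (\<lambda>v. v \<in> tangent_space x\<^sub>k) v\<^sub>k"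
    using v\<^sub>k z_min by (simp add: is_arg_min_linorder tangent_space_def F_le_iff z)
  moreover have "v = v\<^sub>k" if "is_arg_min F (\<lambda>v. v \<in> tangent_space x\<^sub>k) v" for v
  proof -
    have "x\<^sub>k \<bullet> v = 0" "F v \<le> F v\<^sub>k"
      using that v\<^sub>k by (auto simp: is_arg_min_linorder tangent_space_def)
    then have "P (c *\<^sub>R (x\<^sub>k + v)) \<le> P z"
      using v\<^sub>k by (simp add: F_le_iff z)
    \<comment> \<open>A point with \<open>P\<close>-value at most \<open>P z\<close> is itself a
      global minimizer of \<open>P\<close>, hence equal to \<open>z\<close>.\<close>
    then have "c *\<^sub>R (x\<^sub>k + v) = c *\<^sub>R (x\<^sub>k + v\<^sub>k)"
      unfolding z using z_unique z_min order_trans by blast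
    then show ?thesis
      using c by simp
  qed
  ultimately show ?thesis
    unfolding is_the_argmin_def F_def G_def by blast
qed

end
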